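(* Let $a>0$, $b>0$ and $1<p<3$ be given constants. Consider, for $\lambda>0$, the problem $$-(b+a\Vert u'\Vert^2)\,u''(x)=\lambda u(x)^p,\ x\in I,\qquad u(x)>0,\ x\in I,\qquad u(\pm1)=0, \qquad ( * )$$ on $I=(-1,1)$. For $\lambda>0$ put $$L(\lambda):=\frac{p-1}{2}\,\lambda^{2/(p-1)}\,\Vert W_p'\Vert^{-2}\left(\frac{2b}{3-p}\right)^{(p-3)/(p-1)}.$$ (a) If $L(\lambda)>a$, then $( * )$ has exactly two solutions. (b) If $L(\lambda)=a$, then $( * )$ has exactly one solution. (c) If $L(\lambda)<a$, then $( * )$ has no solutions.
   Context: $I:=(-1,1)$ and $\Vert v'\Vert:=\left(\int_I v'(x)^2\,dx\right)^{1/2}$. Solutions are classical, i.e. $u\in C^2(\bar I)$. For $p>0$, $p\ne1$, $W_p$ denotes the unique solution (known to exist and be unique) of $-W''(x)=W(x)^p$ and $W(x)>0$ for $x\in I$, $W(-1)=W(1)=0$. *)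

theory Defs
  imports "HOL-Analysis.Analysis"
begin

abbreviation I :: "real set" where "I \<equiv> {-1<..<1}"

abbreviation I_cl :: "real set" where "I_cl \<equiv> {-1..1}"

text \<open>Twice continuously differentiable on \<open>S\<close>; at boundary points of a closed interval the
  derivatives are one-sided.\<close>

definition C2_on :: "real set \<Rightarrow> (real \<Rightarrow> real) \<Rightarrow> bool" where
  "C2_on S u \<longleftrightarrow> (\<exists>u' u''.
     (\<forall>x\<in>S. (u has_real_derivative u' x) (at x within S)) \<and>
     (\<forall>x\<in>S. (u' has_real_derivative u'' x) (at x within S)) \<and>
     continuous_on S u'')"

definition L2_norm_I :: "(real \<Rightarrow> real) \<Rightarrow> real" where
  "L2_norm_I v = sqrt (integral I (\<lambda>x. (v x)\<^sup>2))"

text \<open>Functions on the closed interval are represented as extensional functions, so that equality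
  and counting of solutions refer to values on \<open>I_cl\<close> only. The derivatives \<open>deriv u\<close> and
  \<open>deriv (deriv u)\<close> are used only at points of the open set \<open>I\<close>, where they do not depend on the
  values outside \<open>I_cl\<close>.\<close>

definition positive_dirichlet_C2 :: "(real \<Rightarrow> real) \<Rightarrow> bool" where
  "positive_dirichlet_C2 u \<longleftrightarrow>
     u \<in> extensional I_cl \<and> C2_on I_cl u \<and> (\<forall>x\<in>I. u x > 0) \<and> u (-1) = 0 \<and> u 1 = 0"

definition W :: "real \<Rightarrow> real \<Rightarrow> real" where
  "W p = (THE w. positive_dirichlet_C2 w \<and> (\<forall>x\<in>I. - deriv (deriv w) x = w x powr p))"

definition kirchhoff_solutions :: "real \<Rightarrow> real \<Rightarrow> real \<Rightarrow> real \<Rightarrow> (real \<Rightarrow> real) set" where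
  "kirchhoff_solutions a b p lam =
     {u. positive_dirichlet_C2 u \<and>
         (\<forall>x\<in>I. - (b + a * (L2_norm_I (deriv u))\<^sup>2) * deriv (deriv u) x = lam * u x powr p)}"

definition L :: "real \<Rightarrow> real \<Rightarrow> real \<Rightarrow> real" where
  "L b p lam =
     (p - 1) / 2 * lam powr (2 / (p - 1)) * L2_norm_I (deriv (W p)) powi (-2)
       * (2 * b / (3 - p)) powr ((p - 3) / (p - 1))"

end

theory Submission
  imports Defs
begin

text \<open>
  Dividing by the constant \<open>b + a \<parallel>u'\<parallel>\<^sup>2\<close> and rescaling shows that \<open>u\<close> solves the nonlocal problem
  iff \<open>u = t W\<^sub>p\<close> with \<open>t > 0\<close> and \<open>b + a \<parallel>W\<^sub>p'\<parallel>\<^sup>2 t\<^sup>2 = \<lambda> t\<^bsup>p-1\<^esup>\<close>. Since \<open>0 < p - 1 < 2\<close>, the function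
  \<open>\<lambda> t\<^bsup>p-1\<^esup> - a \<parallel>W\<^sub>p'\<parallel>\<^sup>2 t\<^sup>2\<close> increases from \<open>0\<close> to a maximum and then decreases to \<open>-\<infinity>\<close>; its maximum
  equals \<open>b (L(\<lambda>)/a)\<^bsup>(p-1)/(3-p)\<^esup>\<close>, and comparing it with \<open>b\<close> gives the three cases.

  \<open>W\<^sub>p\<close> is unique because a solution, viewed from its maximum in either direction and rescaled to
  height \<open>1\<close>, solves one fixed initial value problem. The equal lengths in the two directions put the
  maximum at \<open>0\<close>, and the length then determines the height. For existence, energy conservation makes
  \<open>w = 1 - Y\<^sup>2\<close> a solution of \<open>-w'' = w\<^sup>p\<close> when \<open>Y\<close> inverts \<open>X(y) = \<integral>\<^sub>0\<^bsup>y\<^esup> c/k\<close>, where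
  \<open>k(y)\<^sup>2 = (1 - (1 - y\<^sup>2)\<^bsup>p+1\<^esup>)/y\<^sup>2\<close> and \<open>c\<^sup>2 = 2(p + 1)\<close>; substituting \<open>1 - y\<^sup>2\<close> for \<open>w\<close> removes the
  singularity of the time map at the maximum.
\<close>

section \<open>An explicit solution of the Emden equation\<close>

text \<open>The cut-off extends the power to the whole line, so a profile built from it continues
  past its zeros with two-sided derivatives. At \<open>z = 0\<close> the difference quotient is
  bounded by \<open>|y| powr p\<close>, which tends to 0.\<close>

lemma max_powr_has_real_derivative:
  fixes p z :: real
  assumes "p > 0"
  shows "((\<lambda>z. max 0 z powr (p + 1)) has_real_derivative (p + 1) * max 0 z powr p) (at z)"
proof -
  consider "z > 0" | "z < 0" | "z = 0" by linarith
  then show ?thesis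
  proof cases
    case 1
    have "((\<lambda>z. z powr (p + 1)) has_real_derivative (p + 1) * z powr (p + 1 - 1)) (at z)"
      using 1 by (rule has_real_derivative_powr)
    then show ?thesis
      using 1 by (rule_tac has_field_derivative_transform_within_open[of _ _ _ "{0<..}"]) auto
  next
    case 2
    have "((\<lambda>z. 0) has_real_derivative 0) (at z)" by simp
    then have "((\<lambda>z. max 0 z powr (p + 1)) has_real_derivative 0) (at z)"
      using 2 by (rule_tac has_field_derivative_transform_within_open[of _ _ _ "{..<0}"]) auto
    then show ?thesis using 2 by simp
  next
    case 3
    have "((\<lambda>y::real. \<bar>y\<bar> powr p) \<longlongrightarrow> 0) (at 0)"
      using assms by (intro tendsto_eq_intros | simp)+
    moreover have "\<bar>max 0 y powr (p + 1) / y\<bar> \<le> \<bar>y\<bar> powr p" for y :: real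
      using powr_mult_base[of y p] by (cases "y > 0") (simp_all add: max_def add.commute field_simps)
    ultimately have "((\<lambda>y::real. max 0 y powr (p + 1) / y) \<longlongrightarrow> 0) (at 0)"
      by (rule_tac Lim_null_comparison[where g = "\<lambda>y. \<bar>y\<bar> powr p"]) (simp_all add: eventually_at_filter)
    then show ?thesis using 3 by (simp add: has_field_derivative_iff)
  qed
qed

text \<open>For height 1, energy conservation reads \<open>w'^2 = 2 (1 - w^(p+1)) / (p+1)\<close>.
  With \<open>w = 1 - Y^2\<close> it becomes the regular equation \<open>Y' = k(Y) / c\<close>,
  solved by inverting a primitive of \<open>c / k\<close>. The interval is whatever results; it is
  rescaled to \<open>I_cl\<close> later.\<close>

lemma emden_profile_exists:
  fixes p :: real
  assumes "p > 0"
  obtains \<alpha> \<beta> :: real and w w' :: "real \<Rightarrow> real" where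
    "\<alpha> < \<beta>"
    "\<forall>x\<in>{\<alpha>..\<beta>}. (w has_real_derivative w' x) (at x)"
    "\<forall>x\<in>{\<alpha>..\<beta>}. (w' has_real_derivative - (w x powr p)) (at x)"
    "\<forall>x\<in>{\<alpha><..<\<beta>}. w x > 0" "w \<alpha> = 0" "w \<beta> = 0"
proof -
  \<comment> \<open>With \<open>z = 1 - w\<close> this is the energy term
    \<open>1 - w^(p+1)\<close>, cut off for negative \<open>w\<close>.\<close>
  define \<phi> where "\<phi> z = 1 - max 0 (1 - z) powr (p + 1)" for z :: real
  have D\<phi>: "(\<phi> has_real_derivative (p + 1) * max 0 (1 - z) powr p) (at z)" for z
    unfolding \<phi>_def
    by (rule derivative_eq_intros DERIV_chain2[OF max_powr_has_real_derivative[OF assms]] refl | simp)+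
  have \<phi>_pos: "\<phi> z > 0" if "z > 0" for z
  proof -
    have "max 0 (1 - z) powr (p + 1) < 1 powr (p + 1)"
      using that assms by (intro powr_less_mono2) auto
    then show ?thesis by (simp add: \<phi>_def)
  qed
  have "(\<phi> has_real_derivative (p + 1)) (at 0)"
    using D\<phi>[of 0] by simp
  \<comment> \<open>The Caratheodory slope function is \<open>\<phi> z / z\<close>, extended
    continuously by \<open>p + 1\<close> at \<open>z = 0\<close>, which corresponds to the maximum
    of the profile.\<close>
  then obtain g where g': "\<forall>z. \<phi> z - \<phi> 0 = g z * (z - 0)" "isCont g 0" "g 0 = p + 1"
    unfolding CARAT_DERIV by blast
  moreover have "\<phi> 0 = 0" by (simp add: \<phi>_def)
  ultimately have g: "\<And>z. \<phi> z = g z * z" "isCont g 0" "g 0 = p + 1" by simp_all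
  have g_pos: "g z > 0" if "z \<ge> 0" for z
    using that \<phi>_pos[of z] g(1)[of z] g(3) assms
    by (cases "z = 0") (auto simp: zero_less_mult_iff)
  have g_cont: "isCont g z" for z
  proof (cases "z = 0")
    case False
    have "continuous_on (- {0}) (\<lambda>z. \<phi> z / z)"
      using DERIV_isCont[OF D\<phi>] by (intro continuous_at_imp_continuous_on ballI continuous_intros) auto
    then have "continuous_on (- {0}) g"
      by (rule continuous_on_eq) (simp add: g(1))
    then show ?thesis
      using False by (simp add: continuous_on_eq_continuous_at open_Compl)
  qed (use g in simp)
  define k where "k y = sqrt (g (y\<^sup>2))" for y
  have k_pos: "k y > 0" for y by (simp add: k_def g_pos)
  have k_cont: "isCont k y" for y
    unfolding k_def by (intro continuous_intros isCont_o2[OF _ g_cont])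
  have k_sq: "(k y)\<^sup>2 * y\<^sup>2 = \<phi> (y\<^sup>2)" for y
    using g_pos[of "y\<^sup>2"] by (simp add: k_def g(1))
  \<comment> \<open>\<open>w'\<close> will be a multiple of \<open>Y * k(Y)\<close>, so the product
    is differentiated as a whole, without differentiating \<open>k\<close>. Away from 0 it is
    \<open>sgn y * sqrt (\<phi> (y^2))\<close>; at 0 its slope function is \<open>k\<close>
    itself.\<close>
  have Dh: "((\<lambda>y. y * k y) has_real_derivative (p + 1) * max 0 (1 - y\<^sup>2) powr p / k y) (at y)" for y
  proof (cases "y = 0")
    case True
    have "k 0 = (p + 1) / k 0"
      using assms by (simp add: k_def g(3) real_div_sqrt)
    then show ?thesis
      unfolding CARAT_DERIV using True k_cont by (intro exI[of _ k]) auto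
  next
    case False
    have *: "x * k x = sgn x * sqrt (\<phi> (x\<^sup>2))" for x
      using k_pos[of x] unfolding k_sq[symmetric] by (simp add: real_sqrt_mult sgn_if)
    have pos: "\<phi> (y\<^sup>2) > 0" using False by (intro \<phi>_pos) auto
    have "((\<lambda>x. \<phi> (x\<^sup>2)) has_real_derivative (p + 1) * max 0 (1 - y\<^sup>2) powr p * (2 * y)) (at y)"
      by (rule DERIV_chain2[OF D\<phi>]) (auto intro!: derivative_eq_intros)
    then have "((\<lambda>x. sgn y * sqrt (\<phi> (x\<^sup>2))) has_real_derivative
        sgn y * ((p + 1) * max 0 (1 - y\<^sup>2) powr p * (2 * y) * (inverse (sqrt (\<phi> (y\<^sup>2))) / 2))) (at y)"
      using pos
      by (auto intro!: derivative_eq_intros)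
    moreover have "sgn y * ((p + 1) * max 0 (1 - y\<^sup>2) powr p * (2 * y) * (inverse (sqrt (\<phi> (y\<^sup>2))) / 2))
        = (p + 1) * max 0 (1 - y\<^sup>2) powr p / k y"
    proof -
      have "sqrt (\<phi> (y\<^sup>2)) = k y * \<bar>y\<bar>"
        using k_pos[of y] unfolding k_sq[symmetric] by (simp add: real_sqrt_mult)
      then show ?thesis
        using False k_pos[of y]
        by (cases "y > 0") (simp_all add: divide_simps)
    qed
    ultimately have "((\<lambda>x. sgn y * sqrt (\<phi> (x\<^sup>2))) has_real_derivative
        (p + 1) * max 0 (1 - y\<^sup>2) powr p / k y) (at y)" by (rule DERIV_cong)
    moreover have "sgn y * sqrt (\<phi> (x\<^sup>2)) = x * k x" if "dist x y < \<bar>y\<bar>" for x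
    proof -
      have "sgn x = sgn y" using that by (auto simp: sgn_if dist_real_def split: if_splits)
      then show ?thesis by (simp only: *)
    qed
    ultimately show ?thesis
      using False by (auto intro: has_field_derivative_transform_within[where d = "\<bar>y\<bar>"])
  qed
  define c where "c = sqrt (2 * (p + 1))"
  have c: "c > 0" "c\<^sup>2 = 2 * (p + 1)" using assms by (auto simp: c_def)
  \<comment> \<open>The zeros of \<open>w\<close> belong to \<open>y = -1\<close> and
    \<open>y = 1\<close>; the larger interval leaves room for two-sided derivatives there.\<close>
  have "continuous_on {-2..2} (\<lambda>y. c / k y)"
    using k_cont k_pos less_imp_neq[OF k_pos]
    by (intro continuous_at_imp_continuous_on ballI continuous_intros) auto
  then have "\<exists>X. \<forall>y\<in>{-2..2}. (X has_vector_derivative c / k y) (at y within {-2..2})"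
    by (rule antiderivative_continuous) (intro exI ballI)
  then obtain X where "\<forall>y\<in>{-2..2}. (X has_vector_derivative c / k y) (at y within {-2..2})" ..
  then have X: "(X has_real_derivative c / k y) (at y within {-2..2})" if "y \<in> {-2..2}" for y
    using that unfolding has_real_derivative_iff_has_vector_derivative by (rule bspec)
  have X_cont: "continuous_on {-2..2} X"
    by (rule DERIV_continuous_on[OF X])
  have DX: "(X has_real_derivative c / k y) (at y)" if "y \<in> {-2<..<2}" for y
    using X[of y] that by (simp add: at_within_interior[of y "{-2..2}"])
  have X_less: "X y < X z" if "y < z" "y \<in> {-2..2}" "z \<in> {-2..2}" for y z
  proof (rule DERIV_pos_imp_increasing_open[OF that(1)])
    show "\<exists>d. (X has_real_derivative d) (at t) \<and> d > 0" if "y < t" "t < z" for t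
      using DX[of t] k_pos[of t] c(1) that \<open>y \<in> _\<close> \<open>z \<in> _\<close>
      by (intro exI[of _ "c / k t"]) auto
    show "continuous_on {y..z} X"
      using that by (intro continuous_on_subset[OF X_cont]) auto
  qed
  have X_inj: "inj_on X {-2..2}"
    by (rule linorder_inj_onI) (use X_less in \<open>auto simp: less_le\<close>)
  define Y where "Y = the_inv_into {-2..2} X"
  have YX: "Y (X y) = y" if "y \<in> {-2..2}" for y
    unfolding Y_def using X_inj that by (rule the_inv_into_f_f)
  have image: "\<exists>y\<in>{-2..2}. x = X y" if "x \<in> {X (-2)..X 2}" for x
    using IVT'[of X "-2" x 2] that X_cont by fastforce
  have XY: "X (Y x) = x" and Y_range: "Y x \<in> {-2..2}" if "x \<in> {X (-2)..X 2}" for x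
    using image[OF that] YX by auto
  have "continuous_on (X ` {-2..2}) Y"
    by (intro continuous_on_inv X_cont) (auto simp: YX)
  then have Y_cont: "continuous_on {X (-2)..X 2} Y"
    by (rule continuous_on_subset) (use image in blast)
  have DY: "(Y has_real_derivative k (Y x) / c) (at x)" if "x \<in> {X (-2)<..<X 2}" for x
  proof -
    have "Y x \<noteq> -2" "Y x \<noteq> 2"
      using XY[of x] that by auto
    with Y_range[of x] that have "Y x \<in> {-2<..<2}" by auto
    moreover have "isCont Y x"
      using continuous_on_interior[OF Y_cont] that by simp
    ultimately have "(Y has_real_derivative inverse (c / k (Y x))) (at x)"
      using that c(1) k_pos[of "Y x"] XY
      by (intro DERIV_inverse_function[of X _ _ _ "X (-2)" "X 2"] DX) auto
    then show ?thesis by simp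
  qed
  define w where "w x = 1 - (Y x)\<^sup>2" for x
  define w' where "w' x = - (2 / c) * (Y x * k (Y x))" for x
  have ends: "X (-2) < X (-1)" "X (-1) < X 1" "X 1 < X 2"
    by (auto intro: X_less)
  have Y_mono: "- 1 < Y x" if "X (-1) < x" "x \<le> X 2" for x
    using that ends X_less[of "Y x" "-1"] XY[of x] Y_range[of x] by (cases "Y x = -1"; force)
  have Y_mono': "Y x < 1" if "x < X 1" "X (-2) \<le> x" for x
    using that ends X_less[of 1 "Y x"] XY[of x] Y_range[of x] by (cases "Y x = 1"; force)
  have "(w has_real_derivative w' x) (at x) \<and> (w' has_real_derivative - (w x powr p)) (at x)"
    if x: "x \<in> {X (-1)..X 1}" for x
  proof
    from x have x': "x \<in> {X (-2)<..<X 2}" using ends by auto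
    show "(w has_real_derivative w' x) (at x)"
      unfolding w_def w'_def
      by (rule derivative_eq_intros DY[OF x'] refl | simp)+
    \<comment> \<open>Between the two zeros the cut-off \<open>max 0\<close> is inactive, so the
      derivative of \<open>w'\<close> involves the true power of \<open>w\<close>.\<close>
    have "Y x \<in> {-1..1}"
      using x ends Y_mono[of x] Y_mono'[of x] YX[of 1] YX[of "-1"]
      by (cases "x = X 1"; cases "x = X (-1)") auto
    then have "w x \<ge> 0"
      unfolding w_def using abs_square_le_1[of "Y x"] by auto
    then have "- (2 / c) * ((p + 1) * max 0 (1 - (Y x)\<^sup>2) powr p / k (Y x) * (k (Y x) / c))
        = - (2 * (p + 1) / c\<^sup>2) * w x powr p"
      using k_pos[of "Y x"] by (simp add: w_def power2_eq_square)
    also have "\<dots> = - (w x powr p)"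
      using c assms by simp
    finally have "- (2 / c) * ((p + 1) * max 0 (1 - (Y x)\<^sup>2) powr p / k (Y x) * (k (Y x) / c))
        = - (w x powr p)" .
    moreover have "(w' has_real_derivative
        - (2 / c) * ((p + 1) * max 0 (1 - (Y x)\<^sup>2) powr p / k (Y x) * (k (Y x) / c))) (at x)"
      unfolding w'_def by (intro DERIV_cmult DERIV_chain2[OF Dh DY[OF x']])
    ultimately show "(w' has_real_derivative - (w x powr p)) (at x)" by simp
  qed
  moreover have "w x > 0" if "x \<in> {X (-1)<..<X 1}" for x
  proof -
    have "\<bar>Y x\<bar> < 1" using that Y_mono[of x] Y_mono'[of x] ends by auto
    then show ?thesis by (simp add: w_def abs_square_less_1)
  qed
  moreover have "w (X (-1)) = 0" "w (X 1) = 0" by (simp_all add: w_def YX)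
  ultimately show ?thesis
    using ends(2) by (intro that[of "X (-1)" "X 1" w w']) blast+
qed

section \<open>Uniqueness for the initial value problem\<close>

text \<open>Mean value theorem: since \<open>p \<ge> 1\<close>, the derivative
  \<open>p t^(p-1)\<close> is at most \<open>p B^(p-1)\<close> on the interval.\<close>

lemma powr_lipschitz:
  fixes p B x y :: real
  assumes "p \<ge> 1" "x \<in> {0..B}" "y \<in> {0..B}"
  shows "\<bar>x powr p - y powr p\<bar> \<le> p * B powr (p - 1) * \<bar>x - y\<bar>"
proof -
  have less: "\<bar>x powr p - y powr p\<bar> \<le> p * B powr (p - 1) * \<bar>x - y\<bar>"
    if xy: "x < y" "0 \<le> x" "y \<le> B" for x y
  proof -
    have "continuous_on {x..y} (\<lambda>t. t powr p)"
      using xy assms(1) by (intro continuous_on_powr' continuous_intros) auto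
    moreover have "((\<lambda>t. t powr p) has_real_derivative p * t powr (p - 1)) (at t)" if "x < t" for t
      using xy that by (intro has_real_derivative_powr) auto
    ultimately obtain t where t: "x < t" "t < y" "y powr p - x powr p = (y - x) * (p * t powr (p - 1))"
      using MVT[of x y "\<lambda>t. t powr p"] xy DERIV_unique
      by (smt (verit, best) real_differentiable_def)
    have "t powr (p - 1) \<le> B powr (p - 1)"
      using t xy assms(1) by (intro powr_mono2) auto
    then have "(y - x) * (p * t powr (p - 1)) \<le> (y - x) * (p * B powr (p - 1))"
      using xy assms(1) by (intro mult_left_mono) auto
    moreover have "x powr p \<le> y powr p"
      using xy assms(1) by (intro powr_mono2) auto
    ultimately show ?thesis
      unfolding abs_minus_commute[of x y] abs_minus_commute[of "x powr p"]
      using t(3) xy by (simp add: mult.commute)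
  qed
  show ?thesis
  proof (cases x y rule: linorder_cases)
    case greater
    then show ?thesis
      using less[of y x] assms by (simp add: abs_minus_commute)
  qed (use less[of x y] assms in auto)
qed

text \<open>Gronwall argument: the squared distance of the two solutions in phase space, damped by
  an exponential, starts at 0 and cannot increase. The Lipschitz bound is asked for only along the
  two solutions, because powers are Lipschitz only on bounded ranges.\<close>

lemma second_order_ode_unique:
  fixes f f' g g' F :: "real \<Rightarrow> real" and R B K :: real
  assumes f: "continuous_on {0..R} f" "continuous_on {0..R} f'"
      "\<And>x. x \<in> {0<..<R} \<Longrightarrow> (f has_real_derivative f' x) (at x)"
      "\<And>x. x \<in> {0<..<R} \<Longrightarrow> (f' has_real_derivative F (f x)) (at x)"
    and g: "continuous_on {0..R} g" "continuous_on {0..R} g'"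
      "\<And>x. x \<in> {0<..<R} \<Longrightarrow> (g has_real_derivative g' x) (at x)"
      "\<And>x. x \<in> {0<..<R} \<Longrightarrow> (g' has_real_derivative F (g x)) (at x)"
    and init: "f 0 = g 0" "f' 0 = g' 0"
    and lip: "\<And>x. x \<in> {0<..<R} \<Longrightarrow> \<bar>F (f x) - F (g x)\<bar> \<le> K * \<bar>f x - g x\<bar>"
    and x: "x \<in> {0..R}"
  shows "f x = g x"
proof (cases "x = 0")
  case False
  \<comment> \<open>The rate \<open>1 + |K|\<close> absorbs both cross terms of the derivative:
    \<open>2 h h' \<le> h^2 + h'^2\<close> and \<open>2 h' k \<le> |K| (h^2 + h'^2)\<close>.\<close>
  define E where "E t = ((f t - g t)\<^sup>2 + (f' t - g' t)\<^sup>2) * exp (- (1 + \<bar>K\<bar>) * t)" for t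
  have "E x \<le> E 0"
  proof (rule DERIV_nonpos_imp_decreasing_open[where f = E])
    show "0 \<le> x" using x by simp
    show "continuous_on {0..x} E"
      unfolding E_def using x
      by (intro continuous_intros continuous_on_subset[OF f(1)] continuous_on_subset[OF f(2)]
          continuous_on_subset[OF g(1)] continuous_on_subset[OF g(2)]) auto
    fix t assume "0 < t" "t < x"
    then have t: "t \<in> {0<..<R}" using x by auto
    define h h' k where "h = f t - g t" and "h' = f' t - g' t" and "k = F (f t) - F (g t)"
    have "(E has_real_derivative
        (2 * h * h' + 2 * h' * k - (1 + \<bar>K\<bar>) * (h\<^sup>2 + h'\<^sup>2)) * exp (- (1 + \<bar>K\<bar>) * t)) (at t)"
      unfolding E_def h_def h'_def k_def
      by (rule derivative_eq_intros f(3,4)[OF t] g(3,4)[OF t] refl | simp)+ (simp add: algebra_simps power2_eq_square)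
    moreover have "2 * h * h' + 2 * h' * k \<le> (1 + \<bar>K\<bar>) * (h\<^sup>2 + h'\<^sup>2)"
    proof -
      have "2 * h * h' \<le> h\<^sup>2 + h'\<^sup>2" by (rule sum_squares_bound)
      moreover have "2 * h' * k \<le> \<bar>K\<bar> * (h\<^sup>2 + h'\<^sup>2)"
      proof -
        have "\<bar>k\<bar> \<le> K * \<bar>h\<bar>" unfolding k_def h_def by (rule lip[OF t])
        also have "\<dots> \<le> \<bar>K\<bar> * \<bar>h\<bar>" by (intro mult_right_mono) auto
        finally have "2 * (\<bar>h'\<bar> * \<bar>k\<bar>) \<le> 2 * (\<bar>h'\<bar> * (\<bar>K\<bar> * \<bar>h\<bar>))"
          by (intro mult_left_mono) auto
        also have "\<dots> = \<bar>K\<bar> * (2 * \<bar>h\<bar> * \<bar>h'\<bar>)" by simp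
        also have "\<dots> \<le> \<bar>K\<bar> * (\<bar>h\<bar>\<^sup>2 + \<bar>h'\<bar>\<^sup>2)"
          by (intro mult_left_mono sum_squares_bound) auto
        finally show ?thesis
          using abs_ge_self[of "h' * k"] by (simp add: abs_mult)
      qed
      ultimately show ?thesis by (simp add: distrib_right)
    qed
    ultimately show "\<exists>y. (E has_real_derivative y) (at t) \<and> y \<le> 0"
      by (intro exI conjI) (auto intro!: mult_nonpos_nonneg)
  qed
  then have "(f x - g x)\<^sup>2 + (f' x - g' x)\<^sup>2 \<le> 0"
    using init by (simp add: E_def mult_le_0_iff)
  then show ?thesis
    by (simp add: sum_power2_le_zero_iff)
qed (use init in simp)

text \<open>A solution followed from its maximum to the boundary, normalised to height \<open>1\<close>.\<close>

definition emden_half_profile :: "real \<Rightarrow> real \<Rightarrow> (real \<Rightarrow> real) \<Rightarrow> bool" where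
  "emden_half_profile p R f \<longleftrightarrow> R > 0 \<and> f 0 = 1 \<and> f R = 0 \<and> (\<forall>x\<in>{0..<R}. f x > 0) \<and>
    (\<exists>f'. f' 0 = 0 \<and> continuous_on {0..R} f \<and> continuous_on {0..R} f' \<and>
      (\<forall>x\<in>{0<..<R}. (f has_real_derivative f' x) (at x) \<and>
         (f' has_real_derivative - (f x powr p)) (at x)))"

text \<open>Both profiles start with value 1 and slope 0. On the shorter interval they are
  nonnegative and share a bound \<open>B\<close>, which yields a common Lipschitz constant for the
  power.\<close>

lemma emden_half_profile_eq:
  assumes "p > 1" and f: "emden_half_profile p R f" and g: "emden_half_profile p S g"
    and "R \<le> S" "x \<in> {0..R}"
  shows "f x = g x"
proof -
  obtain f' where f': "f' 0 = 0" "continuous_on {0..R} f" "continuous_on {0..R} f'"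
      "\<And>x. x \<in> {0<..<R} \<Longrightarrow> (f has_real_derivative f' x) (at x)"
      "\<And>x. x \<in> {0<..<R} \<Longrightarrow> (f' has_real_derivative - (f x powr p)) (at x)"
    using f unfolding emden_half_profile_def by blast
  obtain g' where g': "g' 0 = 0" "continuous_on {0..S} g" "continuous_on {0..S} g'"
      "\<And>x. x \<in> {0<..<S} \<Longrightarrow> (g has_real_derivative g' x) (at x)"
      "\<And>x. x \<in> {0<..<S} \<Longrightarrow> (g' has_real_derivative - (g x powr p)) (at x)"
    using g unfolding emden_half_profile_def by blast
  have sub: "{0..R} \<subseteq> {0..S}" using \<open>R \<le> S\<close> by auto
  note g'' = continuous_on_subset[OF g'(2) sub] continuous_on_subset[OF g'(3) sub]
  have "bounded (f ` {0..R} \<union> g ` {0..R})"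
    using f'(2) g''(1) by (simp add: compact_imp_bounded compact_continuous_image)
  then obtain B where "\<forall>z \<in> f ` {0..R} \<union> g ` {0..R}. norm z \<le> B"
    unfolding bounded_iff by blast
  then have B: "f t \<le> B" "g t \<le> B" if "t \<in> {0<..<R}" for t
    using that by (auto simp: abs_le_iff dest!: bspec)
  have nonneg: "f t \<ge> 0" "g t \<ge> 0" if "t \<in> {0<..<R}" for t
    using that f g \<open>R \<le> S\<close> unfolding emden_half_profile_def by (auto intro!: less_imp_le)
  show ?thesis
  proof (rule second_order_ode_unique[where F = "\<lambda>z. - (z powr p)" and f = f and f' = f'
        and g = g and g' = g' and R = R and K = "p * B powr (p - 1)"])
    show "f 0 = g 0" using f g unfolding emden_half_profile_def by auto
    show "f' 0 = g' 0" by (simp add: f'(1) g'(1))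
    fix t assume t: "t \<in> {0<..<R}"
    show "\<bar>- (f t powr p) - - (g t powr p)\<bar> \<le> p * B powr (p - 1) * \<bar>f t - g t\<bar>"
      using powr_lipschitz[of p "f t" B "g t"] B[OF t] nonneg[OF t] assms(1)
      by (simp add: abs_minus_commute)
    show "(g has_real_derivative g' t) (at t)" "(g' has_real_derivative - (g t powr p)) (at t)"
      using g'(4,5)[of t] t \<open>R \<le> S\<close> by auto
  qed (use f' g'' assms in auto)
qed

text \<open>If one length were smaller, the profiles would agree up to it, yet there one vanishes
  while the other is still positive.\<close>

lemma emden_half_profile_length_unique:
  assumes "p > 1" and f: "emden_half_profile p R f" and g: "emden_half_profile p S g"
  shows "R = S"
proof -
  have le: "R = S" if "R \<le> S" "emden_half_profile p R f" "emden_half_profile p S g" for f g R S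
  proof (rule ccontr)
    assume "R \<noteq> S"
    then have "g R > 0"
      using that unfolding emden_half_profile_def by auto
    moreover have "f R = g R"
      using that(2) by (intro emden_half_profile_eq[OF assms(1) that(2,3,1)]) (auto simp: emden_half_profile_def)
    ultimately show False
      using that(2) unfolding emden_half_profile_def by auto
  qed
  show ?thesis
    using le[OF _ f g] le[OF _ g f] by (cases "R \<le> S") auto
qed

section \<open>Solutions of the Emden Dirichlet problem\<close>

lemma C2_onI:
  assumes "\<And>x. x \<in> S \<Longrightarrow> (u has_real_derivative u' x) (at x within S)"
    and "\<And>x. x \<in> S \<Longrightarrow> (u' has_real_derivative u'' x) (at x within S)"
    and "continuous_on S u''"
  shows "C2_on S u"
  unfolding C2_on_def using assms by (intro exI[of _ u'] exI[of _ u'']) simp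

text \<open>In the open interval the one-sided derivatives of \<open>C2_on\<close> are ordinary ones
  and agree with \<open>deriv\<close>; \<open>u'\<close> keeps its continuity up to the boundary,
  which \<open>deriv u\<close> need not have.\<close>

lemma positive_dirichlet_C2_derivs:
  assumes "positive_dirichlet_C2 u"
  obtains u' u'' where
    "continuous_on I_cl u" "continuous_on I_cl u'"
    "\<And>x. x \<in> I \<Longrightarrow> (u has_real_derivative u' x) (at x)"
    "\<And>x. x \<in> I \<Longrightarrow> (u' has_real_derivative u'' x) (at x)"
    "\<And>x. x \<in> I \<Longrightarrow> deriv u x = u' x"
    "\<And>x. x \<in> I \<Longrightarrow> deriv (deriv u) x = u'' x"
proof -
  obtain u' u'' where d:
    "\<And>x. x \<in> I_cl \<Longrightarrow> (u has_real_derivative u' x) (at x within I_cl)"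
    "\<And>x. x \<in> I_cl \<Longrightarrow> (u' has_real_derivative u'' x) (at x within I_cl)"
    using assms unfolding positive_dirichlet_C2_def C2_on_def by blast
  have at: "at x within I_cl = at x" if "x \<in> I" for x
    using that by (intro at_within_interior) simp
  have d1: "(u has_real_derivative u' x) (at x)" if "x \<in> I" for x
    using d(1)[of x] at[OF that] that by simp
  have d2: "(u' has_real_derivative u'' x) (at x)" if "x \<in> I" for x
    using d(2)[of x] at[OF that] that by simp
  have e1: "deriv u x = u' x" if "x \<in> I" for x
    by (rule DERIV_imp_deriv[OF d1[OF that]])
  have "(deriv u has_real_derivative u'' x) (at x)" if "x \<in> I" for x
    by (rule has_field_derivative_transform_within_open[OF d2[OF that], where S = I])
      (use that e1 in simp_all)
  then have e2: "deriv (deriv u) x = u'' x" if "x \<in> I" for x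
    using that DERIV_imp_deriv by blast
  show ?thesis
    by (rule that[of u' u''])
      (use d1 d2 e1 e2 DERIV_continuous_on[OF d(1)] DERIV_continuous_on[OF d(2)] in simp_all)
qed

lemma restrict_scale:
  assumes u: "positive_dirichlet_C2 u" and t: "t > 0"
  defines "v \<equiv> restrict (\<lambda>x. t * u x) I_cl"
  shows positive_dirichlet_C2_scale: "positive_dirichlet_C2 v"
    and deriv_deriv_scale: "x \<in> I \<Longrightarrow> deriv (deriv v) x = t * deriv (deriv u) x"
    and L2_norm_deriv_scale: "L2_norm_I (deriv v) = t * L2_norm_I (deriv u)"
proof -
  show v: "positive_dirichlet_C2 v"
  proof -
    obtain u' u'' where d:
      "\<And>x. x \<in> I_cl \<Longrightarrow> (u has_real_derivative u' x) (at x within I_cl)"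
      "\<And>x. x \<in> I_cl \<Longrightarrow> (u' has_real_derivative u'' x) (at x within I_cl)"
      "continuous_on I_cl u''"
      using u unfolding positive_dirichlet_C2_def C2_on_def by blast
    have "(v has_real_derivative t * u' x) (at x within I_cl)" if "x \<in> I_cl" for x
      by (rule has_field_derivative_transform_within[OF DERIV_cmult[OF d(1)[OF that]] zero_less_one that])
        (simp add: v_def)
    moreover have "((\<lambda>x. t * u' x) has_real_derivative t * u'' x) (at x within I_cl)" if "x \<in> I_cl" for x
      by (rule DERIV_cmult[OF d(2)[OF that]])
    moreover have "continuous_on I_cl (\<lambda>x. t * u'' x)"
      by (intro continuous_intros d(3))
    ultimately have "C2_on I_cl v"
      by (rule C2_onI)
    then show ?thesis
      using u t unfolding positive_dirichlet_C2_def by (simp add: v_def)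
  qed
  obtain u' u'' where d: "\<And>x. x \<in> I \<Longrightarrow> (u has_real_derivative u' x) (at x)"
    "\<And>x. x \<in> I \<Longrightarrow> (u' has_real_derivative u'' x) (at x)"
    "\<And>x. x \<in> I \<Longrightarrow> deriv u x = u' x"
    "\<And>x. x \<in> I \<Longrightarrow> deriv (deriv u) x = u'' x"
    using positive_dirichlet_C2_derivs[OF u] by metis
  have e: "deriv v x = t * deriv u x" if "x \<in> I" for x
  proof -
    have "(v has_real_derivative t * u' x) (at x)"
      by (rule has_field_derivative_transform_within_open[OF DERIV_cmult[OF d(1)[OF that]], where S = I])
        (use that in \<open>simp_all add: v_def\<close>)
    then show ?thesis using d(3)[OF that] DERIV_imp_deriv by simp
  qed
  show "deriv (deriv v) x = t * deriv (deriv u) x" if "x \<in> I"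
  proof -
    have "(deriv v has_real_derivative t * u'' x) (at x)"
      by (rule has_field_derivative_transform_within_open[OF DERIV_cmult[OF d(2)[OF that]], where S = I])
        (use that e d(3) in simp_all)
    then show ?thesis using d(4)[OF that] DERIV_imp_deriv by simp
  qed
  have "integral I (\<lambda>x. (deriv v x)\<^sup>2) = integral I (\<lambda>x. t\<^sup>2 * (deriv u x)\<^sup>2)"
    by (rule integral_cong) (simp add: e power_mult_distrib)
  then show "L2_norm_I (deriv v) = t * L2_norm_I (deriv u)"
    using t by (simp add: L2_norm_I_def real_sqrt_mult)
qed

text \<open>A vanishing norm would force the continuous \<open>u'\<close> to vanish, making
  \<open>u\<close> constant on \<open>{-1..0}\<close> although
  \<open>u (-1) = 0 < u 0\<close>.\<close>

lemma L2_norm_deriv_pos: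
  assumes "positive_dirichlet_C2 u"
  shows "L2_norm_I (deriv u) > 0"
proof -
  obtain u' u'' where d: "continuous_on I_cl u" "continuous_on I_cl u'"
    "\<And>x. x \<in> I \<Longrightarrow> (u has_real_derivative u' x) (at x)"
    "\<And>x. x \<in> I \<Longrightarrow> deriv u x = u' x"
    using positive_dirichlet_C2_derivs[OF assms] by metis
  have "integral I (\<lambda>x. (deriv u x)\<^sup>2) = integral I_cl (\<lambda>x. (u' x)\<^sup>2)"
    unfolding integral_open_interval_real by (rule integral_cong) (simp add: d(4))
  moreover have "integral I_cl (\<lambda>x. (u' x)\<^sup>2) \<noteq> 0"
  proof
    assume "integral I_cl (\<lambda>x. (u' x)\<^sup>2) = 0"
    then have "\<forall>x\<in>I_cl. (u' x)\<^sup>2 = 0"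
      by (subst (asm) integral_eq_0_iff) (auto intro!: continuous_intros d(2))
    then have "(u has_real_derivative 0) (at x)" if "-1 < x" "x < 0" for x
      using d(3)[of x] that by auto
    then have "u 0 = u (-1)"
      by (intro DERIV_isconst_end continuous_on_subset[OF d(1)]) auto
    moreover have "u 0 > 0" "u (-1) = 0"
      using assms by (simp_all add: positive_dirichlet_C2_def)
    ultimately show False by simp
  qed
  moreover have "integral I_cl (\<lambda>x. (u' x)\<^sup>2) \<ge> 0"
    by (intro integral_nonneg integrable_continuous_interval continuous_intros d(2)) auto
  ultimately show ?thesis
    by (simp add: L2_norm_I_def)
qed

section \<open>Symmetry, uniqueness and existence of the Emden solution\<close>

definition emden_solution :: "real \<Rightarrow> (real \<Rightarrow> real) \<Rightarrow> bool" where
  "emden_solution p u \<longleftrightarrow>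
     positive_dirichlet_C2 u \<and> (\<forall>x\<in>I. - deriv (deriv u) x = u x powr p)"

text \<open>The maximum \<open>M\<close> is positive, so it is attained at an interior critical
  point \<open>x0\<close>. The sign \<open>\<sigma>\<close> selects the direction in which the
  solution is followed; the ODE is invariant under reflection.\<close>

lemma emden_solution_half_profiles:
  assumes "emden_solution p u"
  obtains x0 M where "M > 0" "x0 \<in> I"
    "\<And>\<sigma>. \<bar>\<sigma>\<bar> = 1 \<Longrightarrow> emden_half_profile p ((1 - \<sigma> * x0) * M powr ((p - 1) / 2))
       (\<lambda>t. u (x0 + \<sigma> * t / M powr ((p - 1) / 2)) / M)"
proof -
  have u: "positive_dirichlet_C2 u" "\<And>x. x \<in> I \<Longrightarrow> - deriv (deriv u) x = u x powr p"
    using assms unfolding emden_solution_def by auto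
  have pos: "\<And>x. x \<in> I \<Longrightarrow> u x > 0" "u (-1) = 0" "u 1 = 0"
    using u(1) unfolding positive_dirichlet_C2_def by auto
  obtain u' where cont: "continuous_on I_cl u" "continuous_on I_cl u'"
    and d1: "\<And>x. x \<in> I \<Longrightarrow> (u has_real_derivative u' x) (at x)"
    and d2: "\<And>x. x \<in> I \<Longrightarrow> (u' has_real_derivative - (u x powr p)) (at x)"
    using positive_dirichlet_C2_derivs[OF u(1)] u(2) by (metis minus_minus)
  obtain x0 where x0: "x0 \<in> I_cl" "\<And>x. x \<in> I_cl \<Longrightarrow> u x \<le> u x0"
    using continuous_attains_sup[OF _ _ cont(1)] by auto
  define M where "M = u x0"
  have M: "M > 0"
    using x0(2)[of 0] pos(1)[of 0] by (simp add: M_def)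
  then have "x0 \<noteq> -1" "x0 \<noteq> 1" using pos by (auto simp: M_def)
  with x0(1) have x0_I: "x0 \<in> I" by auto
  have "u' x0 = 0"
  proof (rule DERIV_local_max[OF d1[OF x0_I]])
    show "0 < min (1 - x0) (1 + x0)" using x0_I by auto
    show "\<forall>y. \<bar>x0 - y\<bar> < min (1 - x0) (1 + x0) \<longrightarrow> u y \<le> u x0"
      by (auto intro!: x0(2))
  qed
  \<comment> \<open>Dividing \<open>u\<close> by \<open>M\<close> and \<open>t\<close> by
    \<open>c\<close> turns the equation into \<open>f'' = - (M^p / (M c^2)) f^p\<close>; this
    \<open>c\<close> makes the coefficient 1.\<close>
  define c where "c = M powr ((p - 1) / 2)"
  have c: "c > 0" using M by (simp add: c_def)
  have "c\<^sup>2 = M powr (p - 1)"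
    by (simp add: c_def power2_eq_square flip: powr_add)
  then have c2: "M * c\<^sup>2 = M powr p"
    using M by (simp add: powr_mult_base)
  have "emden_half_profile p ((1 - \<sigma> * x0) * c) (\<lambda>t. u (x0 + \<sigma> * t / c) / M)" if \<sigma>: "\<bar>\<sigma>\<bar> = 1" for \<sigma>
  proof -
    have \<sigma>': "\<sigma> = 1 \<or> \<sigma> = -1" using \<sigma> by linarith
    then have \<sigma>_sq: "\<sigma> * \<sigma> = 1" by auto
    define R where "R = (1 - \<sigma> * x0) * c"
    have "1 - \<sigma> * x0 > 0" using \<sigma>' x0_I by auto
    then have R: "R > 0" using c by (simp add: R_def)
    have range_cl: "x0 + \<sigma> * t / c \<in> I_cl" and range: "t < R \<Longrightarrow> x0 + \<sigma> * t / c \<in> I" 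
      if "0 \<le> t" "t \<le> R" for t
    proof -
      have "0 \<le> t / c" "t / c \<le> 1 - \<sigma> * x0" "t < R \<Longrightarrow> t / c < 1 - \<sigma> * x0"
        using that c by (auto simp: R_def field_simps)
      then show "x0 + \<sigma> * t / c \<in> I_cl" "t < R \<Longrightarrow> x0 + \<sigma> * t / c \<in> I"
        using \<sigma>' x0_I by auto
    qed
    have lin: "((\<lambda>t. x0 + \<sigma> * t / c) has_real_derivative \<sigma> / c) (at t)" for t
      using c by (auto intro!: derivative_eq_intros)
    have lin_cont: "continuous_on {0..R} (\<lambda>t. x0 + \<sigma> * t / c)"
      using c by (intro continuous_intros) auto
    show ?thesis
      unfolding emden_half_profile_def R_def[symmetric]
    proof (intro conjI exI[of _ "\<lambda>t. \<sigma> * u' (x0 + \<sigma> * t / c) / (c * M)"] ballI)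
      show "u (x0 + \<sigma> * R / c) / M = 0"
        using c \<sigma>' pos by (auto simp: R_def)
      show "continuous_on {0..R} (\<lambda>t. u (x0 + \<sigma> * t / c) / M)"
        using M range_cl by (intro continuous_intros continuous_on_compose2[OF cont(1) lin_cont]) auto
      show "continuous_on {0..R} (\<lambda>t. \<sigma> * u' (x0 + \<sigma> * t / c) / (c * M))"
        using M c range_cl by (intro continuous_intros continuous_on_compose2[OF cont(2) lin_cont]) auto
    next
      fix t assume "t \<in> {0<..<R}"
      then have I: "x0 + \<sigma> * t / c \<in> I" using range[of t] by auto
      show "((\<lambda>t. u (x0 + \<sigma> * t / c) / M) has_real_derivative \<sigma> * u' (x0 + \<sigma> * t / c) / (c * M)) (at t)"
        by (rule DERIV_cong[OF DERIV_cdivide[OF DERIV_chain2[OF d1[OF I] lin]]]) simp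
      have "\<sigma> * (- (u (x0 + \<sigma> * t / c) powr p) * (\<sigma> / c)) / (c * M)
          = - ((\<sigma> * \<sigma>) * u (x0 + \<sigma> * t / c) powr p / (M * c\<^sup>2))"
        by (simp add: power2_eq_square mult_ac)
      also have "\<dots> = - ((u (x0 + \<sigma> * t / c) / M) powr p)"
        using pos(1)[OF I] M by (simp add: \<sigma>_sq c2 powr_divide)
      finally have eq: "\<sigma> * (- (u (x0 + \<sigma> * t / c) powr p) * (\<sigma> / c)) / (c * M)
          = - ((u (x0 + \<sigma> * t / c) / M) powr p)" .
      show "((\<lambda>t. \<sigma> * u' (x0 + \<sigma> * t / c) / (c * M)) has_real_derivative
          - ((u (x0 + \<sigma> * t / c) / M) powr p)) (at t)"
        unfolding eq[symmetric]
        by (intro DERIV_cdivide DERIV_cmult DERIV_chain2[OF d2[OF I] lin])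
    qed (use R M \<open>u' x0 = 0\<close> pos(1) range in \<open>auto simp: M_def[symmetric]\<close>)
  qed
  with M x0_I show ?thesis
    using that unfolding c_def by blast
qed

lemma emden_solution_unique:
  assumes "p > 1" and u: "emden_solution p u" and v: "emden_solution p v"
  shows "u = v"
proof -
  obtain x0 M where x0: "M > 0" "x0 \<in> I"
    "\<And>\<sigma>. \<bar>\<sigma>\<bar> = 1 \<Longrightarrow> emden_half_profile p ((1 - \<sigma> * x0) * M powr ((p - 1) / 2))
       (\<lambda>t. u (x0 + \<sigma> * t / M powr ((p - 1) / 2)) / M)"
    using emden_solution_half_profiles[OF u] by blast
  obtain y0 M' where y0: "M' > 0" "y0 \<in> I"
    "\<And>\<sigma>. \<bar>\<sigma>\<bar> = 1 \<Longrightarrow> emden_half_profile p ((1 - \<sigma> * y0) * M' powr ((p - 1) / 2))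
       (\<lambda>t. v (y0 + \<sigma> * t / M' powr ((p - 1) / 2)) / M')"
    using emden_solution_half_profiles[OF v] by blast
  note len = emden_half_profile_length_unique[OF assms(1)]
  \<comment> \<open>Both directions of one solution give the same length, so
    \<open>1 - x0 = 1 + x0\<close>.\<close>
  have 0: "x0 = 0" "y0 = 0"
    using len[OF x0(3)[of 1] x0(3)[of "-1"]] len[OF y0(3)[of 1] y0(3)[of "-1"]] x0(1) y0(1)
    by (simp_all add: powr_eq_0_iff)
  \<comment> \<open>With the maximum at 0 the length is a strictly increasing function of the
    height, so equal lengths give equal heights.\<close>
  have "M powr ((p - 1) / 2) = M' powr ((p - 1) / 2)"
    using len[OF x0(3)[of 1] y0(3)[of 1]] by (simp add: 0)
  then have M: "M' = M"
    using x0(1) y0(1) assms(1) powr_less_mono2[of "(p - 1) / 2" M M']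
      powr_less_mono2[of "(p - 1) / 2" M' M] by (cases M M' rule: linorder_cases) auto
  define c where "c = M powr ((p - 1) / 2)"
  have c: "c > 0" using x0(1) by (simp add: c_def)
  have prof: "emden_half_profile p c (\<lambda>t. u (\<sigma> * t / c) / M)" "emden_half_profile p c (\<lambda>t. v (\<sigma> * t / c) / M)"
    if "\<bar>\<sigma>\<bar> = 1" for \<sigma>
    using x0(3)[OF that] y0(3)[OF that] by (simp_all add: 0 M c_def)
  have "u x = v x" if "x \<in> I_cl" for x
  proof -
    define \<sigma> :: real where "\<sigma> = (if x \<ge> 0 then 1 else -1)"
    have \<sigma>: "\<bar>\<sigma>\<bar> = 1" by (simp add: \<sigma>_def)
    have x: "\<sigma> * (\<bar>x\<bar> * c) / c = x" using c by (simp add: \<sigma>_def)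
    have "\<bar>x\<bar> * c \<in> {0..c}" using that c by (auto simp: mult_le_cancel_right1)
    from emden_half_profile_eq[OF assms(1) prof[OF \<sigma>] order_refl this]
    show ?thesis using x0(1) by (simp add: x)
  qed
  moreover have "u \<in> extensional I_cl" "v \<in> extensional I_cl"
    using u v by (simp_all only: emden_solution_def positive_dirichlet_C2_def)
  ultimately show ?thesis
    by (rule_tac extensionalityI[of u I_cl v]) simp_all
qed

text \<open>The explicit profile is transported to \<open>I_cl\<close> by an affine change of
  variable, and its height is adjusted to restore the equation.\<close>

lemma emden_solution_exists:
  assumes "p > 1"
  obtains u where "emden_solution p u"
proof -
  obtain \<alpha> \<beta> and w w' :: "real \<Rightarrow> real" where "\<alpha> < \<beta>"
    "\<forall>x\<in>{\<alpha>..\<beta>}. (w has_real_derivative w' x) (at x)"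
    "\<forall>x\<in>{\<alpha>..\<beta>}. (w' has_real_derivative - (w x powr p)) (at x)"
    "\<forall>x\<in>{\<alpha><..<\<beta>}. w x > 0" "w \<alpha> = 0" "w \<beta> = 0"
    by (rule emden_profile_exists[of p]) (use assms in simp, rule that)
  note w = this(1) bspec[OF this(2)] bspec[OF this(3)] bspec[OF this(4)] this(5,6)
  \<comment> \<open>\<open>M w(m + r x)\<close> has negated second derivative
    \<open>M r^2 w^p\<close>, which must equal \<open>M^p w^p\<close>; hence
    \<open>M^(p-1) = r^2\<close>.\<close>
  define r m M where "r = (\<beta> - \<alpha>) / 2" and "m = (\<alpha> + \<beta>) / 2" and "M = r powr (2 / (p - 1))"
  have r: "r > 0" and ends: "m + r * -1 = \<alpha>" "m + r * 1 = \<beta>"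
    using w(1) by (simp_all add: r_def m_def field_simps)
  then have M: "M > 0" by (simp add: M_def)
  have "2 / (p - 1) * (p - 1) = 2" using assms by (simp add: field_simps)
  then have "M powr (p - 1) = r\<^sup>2"
    using r by (simp only: M_def powr_powr) simp
  then have Mr: "M powr p = M * r\<^sup>2"
    using M powr_mult_base[of M "p - 1"] by simp
  have range_cl: "m + r * x \<in> {\<alpha>..\<beta>}" if "x \<in> I_cl" for x
    using that mult_left_mono[of "-1" x r] mult_left_mono[of x 1 r] r ends by auto
  have range: "m + r * x \<in> {\<alpha><..<\<beta>}" if "x \<in> I" for x
    using that mult_strict_left_mono[of "-1" x r] mult_strict_left_mono[of x 1 r] r ends by auto
  define u where "u x = M * w (m + r * x)" for x
  define u' where "u' x = M * r * w' (m + r * x)" for x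
  have lin: "((\<lambda>x. m + r * x) has_real_derivative r) (at x)" for x
    by (auto intro!: derivative_eq_intros)
  have w_nonneg: "w x \<ge> 0" if "x \<in> {\<alpha>..\<beta>}" for x
    using w(4)[of x] w(5,6) that by (cases "x = \<alpha>"; cases "x = \<beta>") auto
  have d1: "(u has_real_derivative u' x) (at x)" if "x \<in> I_cl" for x
    unfolding u_def u'_def
    by (rule DERIV_cong[OF DERIV_cmult[OF DERIV_chain2[OF w(2)[OF range_cl[OF that]] lin]]]) simp
  have d2: "(u' has_real_derivative - (u x powr p)) (at x)" if "x \<in> I_cl" for x
  proof -
    have "M * r * (- (w (m + r * x) powr p) * r) = - (u x powr p)"
      using w_nonneg[OF range_cl[OF that]] M by (simp add: u_def powr_mult Mr power2_eq_square)
    then show ?thesis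
      unfolding u'_def
      using DERIV_cmult[OF DERIV_chain2[OF w(3)[OF range_cl[OF that]] lin], of "M * r"] by simp
  qed
  \<comment> \<open>\<open>u\<close> has two-sided derivatives even at the endpoints;
    \<open>v\<close> is its extensional representative.\<close>
  define v where "v = restrict u I_cl"
  have "(v has_real_derivative u' x) (at x within I_cl)" if "x \<in> I_cl" for x
    by (rule has_field_derivative_transform_within[OF has_field_derivative_at_within[OF d1[OF that]]
          zero_less_one that]) (simp add: v_def)
  moreover have "(u' has_real_derivative - (u x powr p)) (at x within I_cl)" if "x \<in> I_cl" for x
    by (rule has_field_derivative_at_within[OF d2[OF that]])
  moreover have "continuous_on I_cl (\<lambda>x. - (u x powr p))"
    using assms M w_nonneg[OF range_cl]
    by (intro continuous_intros continuous_on_powr' DERIV_continuous_on[OF has_field_derivative_at_within[OF d1]])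
      (auto simp: u_def)
  ultimately have C2: "C2_on I_cl v"
    by (rule C2_onI)
  have v: "positive_dirichlet_C2 v"
    unfolding positive_dirichlet_C2_def using C2 range M w(4-6) ends by (simp add: v_def u_def)
  have e1: "deriv v x = u' x" if "x \<in> I" for x
  proof (rule DERIV_imp_deriv)
    show "(v has_real_derivative u' x) (at x)"
      by (rule has_field_derivative_transform_within_open[OF d1, where S = I])
        (use that in \<open>auto simp: v_def\<close>)
  qed
  have "deriv (deriv v) x = - (v x powr p)" if "x \<in> I" for x
  proof (rule DERIV_imp_deriv)
    have "(u' has_real_derivative - (v x powr p)) (at x)"
      using d2[of x] that by (simp add: v_def)
    then show "(deriv v has_real_derivative - (v x powr p)) (at x)"
      by (rule has_field_derivative_transform_within_open[where S = I]) (use that e1 in auto)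
  qed
  with v show ?thesis
    by (intro that[of v]) (simp add: emden_solution_def)
qed

text \<open>Existence and uniqueness together justify the definite description defining
  \<open>W\<close>.\<close>

lemma emden_solution_W:
  assumes "p > 1"
  shows "emden_solution p (W p)"
proof -
  obtain u where u: "emden_solution p u"
    using emden_solution_exists[OF assms] .
  have "W p = (THE w. emden_solution p w)"
    by (simp add: W_def emden_solution_def)
  also have "\<dots> = u"
    by (rule the_equality) (use u emden_solution_unique[OF assms] in blast)+
  finally show ?thesis using u by simp
qed

section \<open>Counting the multiples of \<open>W\<^sub>p\<close>\<close>

text \<open>Strict monotonicity allows at most one solution on each side of the peak
  \<open>m\<close>. If the peak exceeds \<open>y\<close>, the low values at 0 and \<open>z\<close>
  give one on each side by the intermediate value theorem.\<close>

lemma card_level_set_unimodal: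
  fixes g :: "real \<Rightarrow> real" and m z y :: real
  assumes cont: "continuous_on {0..} g"
    and inc: "strict_mono_on {0..m} g" and dec: "strict_antimono_on {m..} g"
    and m: "0 < m" "m < z" and low: "g 0 < y" "g z < y"
  shows "g m > y \<Longrightarrow> card {t. 0 < t \<and> g t = y} = 2"
    and "g m = y \<Longrightarrow> card {t. 0 < t \<and> g t = y} = 1"
    and "g m < y \<Longrightarrow> {t. 0 < t \<and> g t = y} = {}"
proof -
  have inc': "g s < g t" if "0 \<le> s" "s < t" "t \<le> m" for s t
    using that by (intro strict_mono_onD[OF inc]) auto
  have dec': "g t < g s" if "m \<le> s" "s < t" for s t
    using monotone_onD[OF dec, of s t] that by auto
  have max: "g t < g m" if "0 \<le> t" "t \<noteq> m" for t
    using inc'[of t m] dec'[of m t] that by linarith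
  show "{t. 0 < t \<and> g t = y} = {}" if "g m < y"
  proof -
    have "g t \<noteq> y" if "0 < t" for t
      using max[of t] that \<open>g m < y\<close> by (cases "t = m") auto
    then show ?thesis by auto
  qed
  show "card {t. 0 < t \<and> g t = y} = 1" if "g m = y"
  proof -
    have "t = m" if "0 < t" "g t = y" for t
      using max[of t] that \<open>g m = y\<close> by (cases "t = m") auto
    then have "{t. 0 < t \<and> g t = y} = {m}"
      using \<open>g m = y\<close> m(1) by blast
    then show ?thesis by simp
  qed
  show "card {t. 0 < t \<and> g t = y} = 2" if "g m > y"
  proof -
    obtain t1 where t1: "0 \<le> t1" "t1 \<le> m" "g t1 = y"
      using IVT'[of g 0 y m] \<open>g m > y\<close> m low continuous_on_subset[OF cont, of "{0..m}"] by auto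
    obtain t2 where t2: "m \<le> t2" "t2 \<le> z" "g t2 = y"
      using IVT2'[of g z y m] \<open>g m > y\<close> m low continuous_on_subset[OF cont, of "{m..z}"] by auto
    have "t = t1 \<or> t = t2" if "0 < t" "g t = y" for t
      using that t1 t2 inc'[of t t1] inc'[of t1 t] dec'[of t t2] dec'[of t2 t]
      by (smt (verit))
    moreover have "0 < t1" "t1 < m" "m < t2"
      using t1 t2 low that m by (auto simp: less_le)
    ultimately have "{t. 0 < t \<and> g t = y} = {t1, t2}"
      using t1(3) t2(3) by (safe; force)
    then show ?thesis
      using \<open>t1 < m\<close> \<open>m < t2\<close> by simp
  qed
qed

text \<open>\<open>l t\<^bsup>q\<^esup> - A t\<^sup>2\<close> attains its maximum \<open>G\<close> at \<open>m\<close>.\<close>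

lemma card_roots_power_quadratic:
  fixes A b l q :: real
  assumes "A > 0" "b > 0" "l > 0" "0 < q" "q < 2"
  defines "m \<equiv> (l * q / (2 * A)) powr (1 / (2 - q))"
  defines "G \<equiv> A * m\<^sup>2 * (2 - q) / q"
  shows "G > b \<Longrightarrow> card {t. 0 < t \<and> b + A * t\<^sup>2 = l * t powr q} = 2"
    and "G = b \<Longrightarrow> card {t. 0 < t \<and> b + A * t\<^sup>2 = l * t powr q} = 1"
    and "G < b \<Longrightarrow> {t. 0 < t \<and> b + A * t\<^sup>2 = l * t powr q} = {}"
proof -
  define g where "g t = l * t powr q - A * t\<^sup>2" for t
  \<comment> \<open>\<open>m\<close> solves \<open>l q m^(q-1) = 2 A m\<close>, the equation for a
    critical point.\<close>
  have m: "m > 0" "m powr (2 - q) = l * q / (2 * A)"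
    using assms(1-5) by (auto simp: m_def powr_powr)
  have split: "t\<^sup>2 = t powr q * t powr (2 - q)" if "t > 0" for t :: real
    using that by (simp add: powr_add[symmetric])
  \<comment> \<open>In this factored form the sign of the derivative is visible from comparing
    \<open>t\<close> with \<open>m\<close>.\<close>
  have Dg: "(g has_real_derivative 2 * A * t powr (q - 1) * (m powr (2 - q) - t powr (2 - q))) (at t)"
    if "t > 0" for t
  proof -
    have "t powr (q - 1) * t powr (2 - q) = t"
      using that by (simp add: powr_add[symmetric])
    then have "l * (q * t powr (q - 1)) - A * (2 * t) = 2 * A * t powr (q - 1) * (m powr (2 - q) - t powr (2 - q))"
      using assms(1) by (simp add: m(2) right_diff_distrib mult.assoc)
    moreover have "(g has_real_derivative l * (q * t powr (q - 1)) - A * (2 * t)) (at t)"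
      unfolding g_def using that
      by (auto intro!: derivative_eq_intros DERIV_cmult has_real_derivative_powr)
    ultimately show ?thesis by simp
  qed
  have cont: "continuous_on {0..} g"
    unfolding g_def using assms(4) by (intro continuous_intros continuous_on_powr') auto
  have inc: "strict_mono_on {0..m} g"
  proof (rule strict_mono_onI)
    fix s t assume st: "s \<in> {0..m}" "t \<in> {0..m}" "s < t"
    show "g s < g t"
    proof (rule DERIV_pos_imp_increasing_open[OF \<open>s < t\<close>])
      show "continuous_on {s..t} g" using st by (intro continuous_on_subset[OF cont]) auto
      fix u assume "s < u" "u < t"
      then show "\<exists>d. (g has_real_derivative d) (at u) \<and> d > 0"
        using st assms(1,5) Dg[of u] powr_less_mono2[of "2 - q" u m]
        by (intro exI conjI, rule_tac Dg) (auto intro!: mult_pos_pos)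
    qed
  qed
  have dec: "strict_antimono_on {m..} g"
  proof (rule monotone_onI)
    fix s t assume st: "s \<in> {m..}" "t \<in> {m..}" "s < t"
    show "g s > g t"
    proof (rule DERIV_neg_imp_decreasing_open[OF \<open>s < t\<close>])
      show "continuous_on {s..t} g" using st m(1) by (intro continuous_on_subset[OF cont]) auto
      fix u assume "s < u" "u < t"
      then show "\<exists>d. (g has_real_derivative d) (at u) \<and> d < 0"
        using st m(1) assms(1,5) Dg[of u] powr_less_mono2[of "2 - q" m u]
        by (intro exI conjI, rule_tac Dg) (auto intro!: mult_pos_neg)
    qed
  qed
  \<comment> \<open>The second argument of \<open>max\<close> is the positive root of
    \<open>l t^q = A t^2\<close>, so \<open>g z \<le> 0 < b\<close>; \<open>m + 1\<close> ensures
    \<open>m < z\<close>.\<close>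
  define z where "z = max (m + 1) ((l / A) powr (1 / (2 - q)))"
  have z: "m < z" "0 < z" using m(1) by (auto simp: z_def)
  have "l / A = ((l / A) powr (1 / (2 - q))) powr (2 - q)"
    using assms(1,3,5) by (simp add: powr_powr)
  also have "\<dots> \<le> z powr (2 - q)"
    using assms(5) by (intro powr_mono2) (auto simp: z_def)
  finally have "z powr q * (l - A * z powr (2 - q)) \<le> 0"
    using assms(1) by (intro mult_nonneg_nonpos) (auto simp: field_simps)
  then have gz: "g z < b"
    using assms(2) by (simp add: g_def split[OF z(2)] algebra_simps)
  have g0: "g 0 < b" using assms(2) by (simp add: g_def)
  have "m powr q * m powr (2 - q) = m\<^sup>2" using split[OF m(1)] by simp
  then have "l * m powr q = 2 * A * m\<^sup>2 / q"
    unfolding m(2) using assms(1,4) by (simp add: field_simps)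
  then have gm: "g m = G"
    using assms(4) by (simp add: g_def G_def field_simps)
  have eq: "(b + A * t\<^sup>2 = l * t powr q) \<longleftrightarrow> g t = b" for t
    by (auto simp: g_def)
  note * = card_level_set_unimodal[OF cont inc dec m(1) z(1) g0 gz, unfolded gm]
  show "G > b \<Longrightarrow> card {t. 0 < t \<and> b + A * t\<^sup>2 = l * t powr q} = 2"
    and "G = b \<Longrightarrow> card {t. 0 < t \<and> b + A * t\<^sup>2 = l * t powr q} = 1"
    and "G < b \<Longrightarrow> {t. 0 < t \<and> b + A * t\<^sup>2 = l * t powr q} = {}"
    unfolding eq by (rule *; assumption)+
qed

text \<open>Both sides are positive, and taking logarithms leaves an identity linear in the
  logarithms of the parameters. For \<open>q = p - 1\<close> and \<open>N\<close> the squared norm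
  of \<open>W'\<close>, it expresses the maximum \<open>G\<close> through
  \<open>L / a\<close>.\<close>

lemma threshold_eq:
  fixes a b l q N :: real
  assumes "a > 0" "b > 0" "l > 0" "0 < q" "q < 2" "N > 0"
  shows "(a * N) * ((l * q / (2 * (a * N))) powr (1 / (2 - q)))\<^sup>2 * (2 - q) / q
    = b * ((q / 2 * l powr (2 / q) / N * (2 * b / (2 - q)) powr ((q - 2) / q)) / a) powr (q / (2 - q))"
    (is "?lhs = ?rhs")
proof -
  have pos: "?lhs > 0" "?rhs > 0" using assms by auto
  have "ln ?lhs = ln a + ln N + 2 * (1 / (2 - q) * (ln l + ln q - (ln 2 + (ln a + ln N)))) + ln (2 - q) - ln q"
    using assms by (simp add: ln_mult ln_div ln_realpow)
  also have "\<dots> = ln b + q / (2 - q) *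
      (ln q - ln 2 + 2 / q * ln l - ln N + (q - 2) / q * (ln 2 + ln b - ln (2 - q)) - ln a)"
    using assms(4,5) by (simp add: divide_simps) (simp add: algebra_simps)
  also have "\<dots> = ln ?rhs"
    using assms by (simp add: ln_mult ln_div)
  finally have "ln ?lhs = ln ?rhs" .
  then show ?thesis using pos by simp
qed

text \<open>Along a fixed solution the nonlocal factor is a constant, so a suitable multiple solves
  the Emden equation and must be \<open>W p\<close>. The condition on \<open>t\<close> says that
  this constant is consistent with the norm of \<open>t W\<close>.\<close>

lemma kirchhoff_solutions_eq_image:
  assumes "a > 0" "b > 0" "p > 1" "lam > 0"
  shows "kirchhoff_solutions a b p lam = (\<lambda>t. restrict (\<lambda>x. t * W p x) I_cl) `
    {t. 0 < t \<and> b + a * (L2_norm_I (deriv (W p)))\<^sup>2 * t\<^sup>2 = lam * t powr (p - 1)}"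
    (is "_ = ?\<Phi> ` ?T")
proof (intro equalityI subsetI)
  have W: "positive_dirichlet_C2 (W p)" "\<And>x. x \<in> I \<Longrightarrow> - deriv (deriv (W p)) x = W p x powr p"
    using emden_solution_W[OF assms(3)] by (auto simp: emden_solution_def)
  have W_pos: "\<And>x. x \<in> I \<Longrightarrow> W p x > 0"
    using W(1) by (simp add: positive_dirichlet_C2_def)
  fix u assume "u \<in> ?\<Phi> ` ?T"
  then obtain t where t: "t > 0" "b + a * (L2_norm_I (deriv (W p)))\<^sup>2 * t\<^sup>2 = lam * t powr (p - 1)"
    and u: "u = ?\<Phi> t" by blast
  have "- (b + a * (L2_norm_I (deriv u))\<^sup>2) * deriv (deriv u) x = lam * u x powr p" if "x \<in> I" for x
  proof -
    have "- (b + a * (L2_norm_I (deriv u))\<^sup>2) * deriv (deriv u) x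
        = (b + a * (L2_norm_I (deriv (W p)))\<^sup>2 * t\<^sup>2) * (t * - deriv (deriv (W p)) x)"
      unfolding u L2_norm_deriv_scale[OF W(1) t(1)] deriv_deriv_scale[OF W(1) t(1) that]
      by (simp add: power_mult_distrib algebra_simps)
    also have "\<dots> = lam * (t * t powr (p - 1)) * W p x powr p"
      unfolding t(2) W(2)[OF that] by (simp add: mult_ac)
    also have "\<dots> = lam * u x powr p"
      using that t(1) W_pos[OF that] by (simp add: u powr_mult powr_mult_base)
    finally show ?thesis .
  qed
  then show "u \<in> kirchhoff_solutions a b p lam"
    using positive_dirichlet_C2_scale[OF W(1) t(1)] unfolding kirchhoff_solutions_def u by blast
next
  fix u assume "u \<in> kirchhoff_solutions a b p lam"
  then have u: "positive_dirichlet_C2 u"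
    "\<And>x. x \<in> I \<Longrightarrow> - (b + a * (L2_norm_I (deriv u))\<^sup>2) * deriv (deriv u) x = lam * u x powr p"
    unfolding kirchhoff_solutions_def by auto
  define D where "D = b + a * (L2_norm_I (deriv u))\<^sup>2"
  have D: "D > 0" using assms by (simp add: D_def add_pos_nonneg)
  \<comment> \<open>Chosen so that \<open>s^p = s lam / D\<close>, which makes \<open>s u\<close> an
    Emden solution.\<close>
  define s where "s = (lam / D) powr (1 / (p - 1))"
  have s: "s > 0" "s powr (p - 1) = lam / D"
    using assms D by (simp_all add: s_def powr_powr)
  define v where "v = restrict (\<lambda>x. s * u x) I_cl"
  have "- deriv (deriv v) x = v x powr p" if "x \<in> I" for x
  proof -
    have "u x > 0" using u(1) that by (simp add: positive_dirichlet_C2_def)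
    then have "v x powr p = s * (lam / D) * u x powr p"
      using that s(1) powr_mult_base[of s "p - 1"] by (simp add: v_def powr_mult s(2))
    moreover have "- deriv (deriv u) x = lam * u x powr p / D"
      using u(2)[OF that] D by (simp add: D_def[symmetric] field_simps)
    moreover have "- deriv (deriv v) x = s * - deriv (deriv u) x"
      unfolding v_def by (simp add: deriv_deriv_scale[OF u(1) s(1) that])
    ultimately show ?thesis by simp
  qed
  then have "emden_solution p v"
    using positive_dirichlet_C2_scale[OF u(1) s(1)] by (simp add: emden_solution_def v_def)
  then have W: "W p = v"
    using emden_solution_unique[OF assms(3)] emden_solution_W[OF assms(3)] by blast
  have "u = ?\<Phi> (1 / s)"
    using u(1) s(1) unfolding W v_def positive_dirichlet_C2_def
    by (rule_tac extensionalityI[of u I_cl]) simp_all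
  moreover have "1 / s \<in> ?T"
  proof -
    have "L2_norm_I (deriv (W p)) = s * L2_norm_I (deriv u)"
      unfolding W v_def by (rule L2_norm_deriv_scale[OF u(1) s(1)])
    then have "b + a * (L2_norm_I (deriv (W p)))\<^sup>2 * (1 / s)\<^sup>2 = D"
      using s(1) by (simp add: D_def power_mult_distrib power_divide)
    also have "\<dots> = lam * (1 / s) powr (p - 1)"
      using s assms D by (simp add: powr_divide)
    finally show ?thesis using s(1) by simp
  qed
  ultimately show "u \<in> ?\<Phi> ` ?T" by blast
qed

theorem theorem1p3:
  fixes a b p lam :: real
  assumes "a > 0" and "b > 0" and "1 < p" and "p < 3" and "lam > 0"
  shows "(L b p lam > a \<longrightarrow> card (kirchhoff_solutions a b p lam) = 2)
       \<and> (L b p lam = a \<longrightarrow> card (kirchhoff_solutions a b p lam) = 1)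
       \<and> (L b p lam < a \<longrightarrow> kirchhoff_solutions a b p lam = {})"
proof -
  define N where "N = (L2_norm_I (deriv (W p)))\<^sup>2"
  define T where "T = {t. 0 < t \<and> b + a * N * t\<^sup>2 = lam * t powr (p - 1)}"
  have W: "positive_dirichlet_C2 (W p)"
    using emden_solution_W[OF assms(3)] by (simp add: emden_solution_def)
  have N: "N > 0"
    using L2_norm_deriv_pos[OF W] by (simp add: N_def)
  \<comment> \<open>Distinct multiples of \<open>W p\<close> differ at 0, so counting solutions
    amounts to counting the factors \<open>t\<close>.\<close>
  have "inj_on (\<lambda>t. restrict (\<lambda>x. t * W p x) I_cl) T"
  proof (rule inj_onI)
    fix s t assume "restrict (\<lambda>x. s * W p x) I_cl = restrict (\<lambda>x. t * W p x) I_cl"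
    then have "s * W p 0 = t * W p 0"
      by (auto dest: fun_cong[where x = 0])
    moreover have "W p 0 > 0"
      using W by (simp add: positive_dirichlet_C2_def)
    ultimately show "s = t" by simp
  qed
  moreover have image: "kirchhoff_solutions a b p lam = (\<lambda>t. restrict (\<lambda>x. t * W p x) I_cl) ` T"
    unfolding T_def N_def by (rule kirchhoff_solutions_eq_image[OF assms(1-3,5)])
  ultimately have card: "card (kirchhoff_solutions a b p lam) = card T"
    by (simp add: card_image)
  define G where "G = a * N * ((lam * (p - 1) / (2 * (a * N))) powr (1 / (2 - (p - 1))))\<^sup>2
    * (2 - (p - 1)) / (p - 1)"
  define q where "q = (p - 1) / (3 - p)"
  have q: "q > 0" using assms by (simp add: q_def)
  have L: "L b p lam = (p - 1) / 2 * lam powr (2 / (p - 1)) / N * (2 * b / (3 - p)) powr ((p - 3) / (p - 1))"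
    by (simp add: L_def N_def power_int_minus field_simps)
  have L_pos: "L b p lam > 0"
    unfolding L using assms N by simp
  have "p - 1 - 2 = p - 3" "2 - (p - 1) = 3 - p" by simp_all
  \<comment> \<open>The exponent \<open>q\<close> is positive, so \<open>G\<close> compares with
    \<open>b\<close> exactly as \<open>L b p lam\<close> compares with \<open>a\<close>.\<close>
  then have G: "G = b * (L b p lam / a) powr q"
    using threshold_eq[of a b lam "p - 1" N] assms N by (simp add: G_def L q_def)
  note roots = card_roots_power_quadratic[of "a * N" b lam "p - 1", folded G_def T_def]
  have "L b p lam > a \<Longrightarrow> G > b"
    using powr_less_mono2[of q 1 "L b p lam / a"] assms(1,2) q by (simp add: G)
  moreover have "L b p lam = a \<Longrightarrow> G = b"
    using assms(1) by (simp add: G)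
  moreover have "L b p lam < a \<Longrightarrow> G < b"
    using powr_less_mono2[of q "L b p lam / a" 1] assms(1,2) q L_pos by (simp add: G)
  moreover have "T = {} \<Longrightarrow> kirchhoff_solutions a b p lam = {}"
    unfolding image by (rule iffD2[OF image_is_empty])
  moreover have "a * N > 0" "p - 1 > 0" "p - 1 < 2" using assms N by simp_all
  ultimately show ?thesis
    using roots[OF _ assms(2,5)] unfolding card by blast
qed

end
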